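(* Let $N$ be a positive integer, $\delta>0$, and $\Pi:\mathbb R^{4n_x+n_w}\to\mathbb R^{n_\Pi}$ a function. Let $\Theta$ be the set of all $\theta\in\mathbb R^{n_\theta}$ such that $(\theta,r)\in\mathbf\Theta(N,\delta,\Pi)$ for some $r$, and suppose $\Theta\neq\emptyset$. Then $(\Theta,\Phi,\Psi)$ is a stable projective parameterization. Furthermore, for each $(\theta,r)\in\mathbf\Theta(N,\delta,\Pi)$ and each data set $\Xi=(\tilde w,\tilde x_1,\dots,\tilde x_N)\in\mathcal D(n_x,n_w,N,T)$ (with $T\ge1$), the function $$\hat J_r(\Xi):=\frac1{NT}\sum_{i=1}^N\sum_{t=1}^T r(\tilde z_i(t))$$ satisfies $$\hat J_r(\Xi)\ \ge\ \frac1N\sum_{i=1}^N J^{SE}_T(a_\theta,\tilde x_i(0),\tilde x_i,\tilde w).$$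
   Context: **Notation.** $\mathbb Z_+$ is the set of nonnegative integers. $A'$ is the transpose; $[a;b]$ is vertical concatenation; $[v]_d$ is the $d$-th entry; $|v|_R^2=v'Rv$ for symmetric $R$; $|v|^2=v'v$; $A\ge B$ for symmetric matrices means $A-B$ is positive semidefinite. **Models.** Fix positive integers $n_x,n_w,n_y,n_\theta$, a matrix $C\in\mathbb R^{n_y\times n_x}$, and sequences $\Phi=\{\phi_i\}_{i=1}^{n_\theta}$, $\Psi=\{\psi_i\}_{i=1}^{n_\theta}$ of real analytic functions $\phi_i:\mathbb R^{n_x}\times\mathbb R^{n_w}\to\mathbb R^{n_x}$, $\psi_i:\mathbb R^{n_x}\to\mathbb R^{n_x}$. For $\theta\in\mathbb R^{n_\theta}$ put $f_\theta(x,w)=\sum_i[\theta]_i\phi_i(x,w)$, $e_\theta(x)=\sum_i[\theta]_i\psi_i(x)$, and, when $e_\theta$ is a bijection, $a_\theta(x,w)=e_\theta^{-1}(f_\theta(x,w))$. For $a:\mathbb R^{n_x}\times\mathbb R^{n_w}\to\mathbb R^{n_x}$, $G_a(x_0,w)$ denotes the sequence $x$ with $x(0)=x_0$ and $x(t)=a(x(t-1),w(t))$ for $t\ge1$. The system given by $a$ is $\ell^2$-incrementally stable if for all $x_0,\hat x_0\in\mathbb R^{n_x}$ and all $w:\mathbb Z_+\to\mathbb R^{n_w}$ the difference $G_a(x_0,w)-G_a(\hat x_0,w)$ is square summable. The triple $(\Theta,\Phi,\Psi)$, with $\Theta\subset\mathbb R^{n_\theta}$ nonempty, is a stable projective parameterization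 if for every $\theta\in\Theta$ the function $e_\theta:\mathbb R^{n_x}\to\mathbb R^{n_x}$ is a bijection and the system $x(t)=a_\theta(x(t-1),w(t))$ is $\ell^2$-incrementally stable. **The set $\mathbf\Theta(N,\delta,\Pi)$.** Let $\mathcal P_N$ be the set of real polynomials in $z=[\xi;x;w]$ ($\xi,x\in\mathbb R^{n_x}$, $w\in\mathbb R^{n_w}$) of total degree at most $N$. Let $v=[\xi;x;w;\Delta;q]$ with $\Delta,q\in\mathbb R^{n_x}$. $\mathbf\Theta(N,\delta,\Pi)$ is the set of pairs $(\theta,r)\in\mathbb R^{n_\theta}\times\mathcal P_N$ for which there exist symmetric $P\in\mathbb R^{n_x\times n_x}$, symmetric $\Sigma_1,\Sigma_2\in\mathbb R^{n_\Pi\times n_\Pi}$ and a scalar $\epsilon>0$ with $P\ge\delta I$, $\Sigma_1\ge0$, $\Sigma_2\ge0$ and, identically in $v$, $$r(z)+2\Delta'[e_\theta(x+\Delta)-e_\theta(x)]-|\Delta|^2_{P+C'C}+|q|_P^2-2q'(f_\theta(x+\Delta,w)-e_\theta(\xi))=\Pi(v)'\Sigma_1\Pi(v),$$ $$2\Delta'[e_\theta(x+\Delta)-e_\theta(x)]-|\Delta|^2_{P+\epsilon I}+|q|_P^2-2q'(f_\theta(x+\Delta,w)-f_\theta(x,w))=\Pi(v)'\Sigma_2\Pi(v).$$ **Data and error.** $\mathcal D(n_x,n_w,N,T)$ is the set of tuples $(\tilde w,\tilde x_1,\dots,\tilde x_N)$ of functions $\tilde w:\{0,\dots,T\}\to\mathbb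 R^{n_w}$, $\tilde x_i:\{0,\dots,T\}\to\mathbb R^{n_x}$; $\tilde z_i(t)=[\tilde x_i(t);\tilde x_i(t-1);\tilde w(t)]$ for $t\in\{1,\dots,T\}$. The $T$-step simulation error is $$J^{SE}_T(a,x_0,\tilde x,\tilde w)=\frac1T\sum_{t=0}^{T-1}|C(\tilde x(t)-x(t))|^2,\qquad x=G_a(x_0,\tilde w).$$ *)

theory Defs
  imports "HOL-Analysis.Analysis"
begin

definition multi_indices :: "('a::euclidean_space \<Rightarrow> nat) set" where
  "multi_indices = {\<alpha>. \<forall>b. b \<notin> Basis \<longrightarrow> \<alpha> b = 0}"

definition monomial_at :: "('a::euclidean_space \<Rightarrow> nat) \<Rightarrow> 'a \<Rightarrow> real" where
  "monomial_at \<alpha> x = (\<Prod>b\<in>Basis. (x \<bullet> b) ^ \<alpha> b)"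

definition multi_indices_upto :: "nat \<Rightarrow> ('a::euclidean_space \<Rightarrow> nat) set" where
  "multi_indices_upto N = {\<alpha> \<in> multi_indices. (\<Sum>b\<in>Basis. \<alpha> b) \<le> N}"

lemma finite_multi_indices_upto:
  "finite (multi_indices_upto N :: ('a::euclidean_space \<Rightarrow> nat) set)"
proof (rule finite_subset)
  show "multi_indices_upto N \<subseteq>
      {\<alpha>::'a \<Rightarrow> nat. \<forall>b. (b \<in> Basis \<longrightarrow> \<alpha> b \<in> {..N}) \<and> (b \<notin> Basis \<longrightarrow> \<alpha> b = 0)}"
  proof
    fix \<alpha> :: "'a \<Rightarrow> nat"
    assume \<alpha>: "\<alpha> \<in> multi_indices_upto N"
    have "\<alpha> b \<le> N" if "b \<in> Basis" for b
    proof -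
      have "\<alpha> b \<le> (\<Sum>b\<in>Basis. \<alpha> b)"
        by (rule member_le_sum[OF that]) simp_all
      also have "\<dots> \<le> N"
        using \<alpha> by (simp add: multi_indices_upto_def)
      finally show ?thesis .
    qed
    moreover have "\<alpha> b = 0" if "b \<notin> Basis" for b
      using \<alpha> that by (simp add: multi_indices_upto_def multi_indices_def)
    ultimately show "\<alpha> \<in> {\<alpha>. \<forall>b. (b \<in> Basis \<longrightarrow> \<alpha> b \<in> {..N}) \<and> (b \<notin> Basis \<longrightarrow> \<alpha> b = 0)}"
      by simp
  qed
  show "finite {\<alpha>::'a \<Rightarrow> nat. \<forall>b. (b \<in> Basis \<longrightarrow> \<alpha> b \<in> {..N}) \<and> (b \<notin> Basis \<longrightarrow> \<alpha> b = 0)}"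
    by (rule finite_set_of_finite_funs) simp_all
qed

text \<open>Real polynomials are identified with the functions they define.\<close>

definition polys_upto :: "nat \<Rightarrow> ('a::euclidean_space \<Rightarrow> real) set" where
  "polys_upto N = {r. \<exists>c. \<forall>z. r z = (\<Sum>\<alpha>\<in>multi_indices_upto N. c \<alpha> * monomial_at \<alpha> z)}"

text \<open>Around every point the function is the sum of a multivariate power series; \<open>has_sum\<close> makes the
  convergence unconditional, that is, absolute.\<close>

definition real_analytic :: "('a::euclidean_space \<Rightarrow> 'b::euclidean_space) \<Rightarrow> bool" where
  "real_analytic f \<longleftrightarrow>
     (\<forall>p. \<exists>\<rho>>0. \<exists>c :: ('a \<Rightarrow> nat) \<Rightarrow> 'b. \<forall>x\<in>ball p \<rho>.
        ((\<lambda>\<alpha>. monomial_at \<alpha> (x - p) *\<^sub>R c \<alpha>) has_sum f x) multi_indices)"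

definition symmetric_mat :: "real^'n^'n \<Rightarrow> bool" where
  "symmetric_mat A \<longleftrightarrow> transpose A = A"

definition wnorm2 :: "real^'n^'n \<Rightarrow> real^'n \<Rightarrow> real" where
  "wnorm2 R v = v \<bullet> (R *v v)"

definition psd :: "real^'n^'n \<Rightarrow> bool" where
  "psd A \<longleftrightarrow> symmetric_mat A \<and> (\<forall>v. 0 \<le> wnorm2 A v)"

definition mat_ge :: "real^'n^'n \<Rightarrow> real^'n^'n \<Rightarrow> bool" where
  "mat_ge A B \<longleftrightarrow> psd (A - B)"

definition f_model ::
  "('k::finite \<Rightarrow> (real^'x) \<times> (real^'w) \<Rightarrow> real^'x) \<Rightarrow> real^'k \<Rightarrow> (real^'x) \<times> (real^'w) \<Rightarrow> real^'x" where
  "f_model \<Phi> \<theta> xw = (\<Sum>i\<in>UNIV. (\<theta> $ i) *\<^sub>R \<Phi> i xw)"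

definition e_model ::
  "('k::finite \<Rightarrow> real^'x \<Rightarrow> real^'x) \<Rightarrow> real^'k \<Rightarrow> real^'x \<Rightarrow> real^'x" where
  "e_model \<Psi> \<theta> x = (\<Sum>i\<in>UNIV. (\<theta> $ i) *\<^sub>R \<Psi> i x)"

text \<open>Only meaningful when \<open>e_model \<Psi> \<theta>\<close> is a bijection.\<close>

definition a_model ::
  "('k::finite \<Rightarrow> (real^'x) \<times> (real^'w) \<Rightarrow> real^'x) \<Rightarrow> ('k \<Rightarrow> real^'x \<Rightarrow> real^'x) \<Rightarrow>
   real^'k \<Rightarrow> (real^'x) \<times> (real^'w) \<Rightarrow> real^'x" where
  "a_model \<Phi> \<Psi> \<theta> xw = inv (e_model \<Psi> \<theta>) (f_model \<Phi> \<theta> xw)"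

primrec G :: "((real^'x) \<times> (real^'w) \<Rightarrow> real^'x) \<Rightarrow> real^'x \<Rightarrow> (nat \<Rightarrow> real^'w) \<Rightarrow> nat \<Rightarrow> real^'x" where
  "G a x0 w 0 = x0"
| "G a x0 w (Suc t) = a (G a x0 w t, w (Suc t))"

definition l2_incrementally_stable :: "((real^'x) \<times> (real^'w) \<Rightarrow> real^'x) \<Rightarrow> bool" where
  "l2_incrementally_stable a \<longleftrightarrow>
     (\<forall>x0 x0' w. summable (\<lambda>t. (norm (G a x0 w t - G a x0' w t))\<^sup>2))"

definition stable_projective_parameterization ::
  "(real^'k) set \<Rightarrow> ('k::finite \<Rightarrow> (real^'x) \<times> (real^'w) \<Rightarrow> real^'x) \<Rightarrow>
   ('k \<Rightarrow> real^'x \<Rightarrow> real^'x) \<Rightarrow> bool" where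
  "stable_projective_parameterization \<Theta> \<Phi> \<Psi> \<longleftrightarrow>
     \<Theta> \<noteq> {} \<and>
     (\<forall>\<theta>\<in>\<Theta>. bij (e_model \<Psi> \<theta>) \<and> l2_incrementally_stable (a_model \<Phi> \<Psi> \<theta>))"

text \<open>The stacked vectors \<open>z = [\<xi>; x; w]\<close> and \<open>v = [\<xi>; x; w; \<Delta>; q]\<close> are nested pairs.\<close>

definition Theta_set ::
  "real^'x^'y \<Rightarrow> ('k::finite \<Rightarrow> (real^'x) \<times> (real^'w) \<Rightarrow> real^'x) \<Rightarrow> ('k \<Rightarrow> real^'x \<Rightarrow> real^'x) \<Rightarrow>
   nat \<Rightarrow> real \<Rightarrow> ((real^'x) \<times> (real^'x) \<times> (real^'w) \<times> (real^'x) \<times> (real^'x) \<Rightarrow> real^'p) \<Rightarrow>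
   ((real^'k) \<times> ((real^'x) \<times> (real^'x) \<times> (real^'w) \<Rightarrow> real)) set" where
  "Theta_set C \<Phi> \<Psi> N \<delta> pi_fun =
     {(\<theta>, r). r \<in> polys_upto N \<and>
       (\<exists>P S1 S2 \<epsilon>. symmetric_mat P \<and> symmetric_mat S1 \<and> symmetric_mat S2 \<and> \<epsilon> > 0 \<and>
          mat_ge P (mat \<delta>) \<and> mat_ge S1 0 \<and> mat_ge S2 0 \<and>
          (\<forall>\<xi> x w \<Delta> q.
             r (\<xi>, x, w) + 2 * (\<Delta> \<bullet> (e_model \<Psi> \<theta> (x + \<Delta>) - e_model \<Psi> \<theta> x))
               - wnorm2 (P + transpose C ** C) \<Delta> + wnorm2 P q
               - 2 * (q \<bullet> (f_model \<Phi> \<theta> (x + \<Delta>, w) - e_model \<Psi> \<theta> \<xi>))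
             = wnorm2 S1 (pi_fun (\<xi>, x, w, \<Delta>, q)) \<and>
             2 * (\<Delta> \<bullet> (e_model \<Psi> \<theta> (x + \<Delta>) - e_model \<Psi> \<theta> x))
               - wnorm2 (P + mat \<epsilon>) \<Delta> + wnorm2 P q
               - 2 * (q \<bullet> (f_model \<Phi> \<theta> (x + \<Delta>, w) - f_model \<Phi> \<theta> (x, w)))
             = wnorm2 S2 (pi_fun (\<xi>, x, w, \<Delta>, q))))}"

text \<open>Functions on \<open>{0..T}\<close> and tuples indexed by \<open>1, \<dots>, N\<close> are extensional functions.\<close>

definition data_sets ::
  "nat \<Rightarrow> nat \<Rightarrow> ((nat \<Rightarrow> real^'w) \<times> (nat \<Rightarrow> nat \<Rightarrow> real^'x)) set" where
  "data_sets N T = ({0..T} \<rightarrow>\<^sub>E UNIV) \<times> ({1..N} \<rightarrow>\<^sub>E ({0..T} \<rightarrow>\<^sub>E UNIV))"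

definition z_data :: "(nat \<Rightarrow> real^'w) \<Rightarrow> (nat \<Rightarrow> real^'x) \<Rightarrow> nat \<Rightarrow> (real^'x) \<times> (real^'x) \<times> (real^'w)" where
  "z_data w x t = (x t, x (t - 1), w t)"

definition J_SE ::
  "real^'x^'y \<Rightarrow> nat \<Rightarrow> ((real^'x) \<times> (real^'w) \<Rightarrow> real^'x) \<Rightarrow> real^'x \<Rightarrow>
   (nat \<Rightarrow> real^'x) \<Rightarrow> (nat \<Rightarrow> real^'w) \<Rightarrow> real" where
  "J_SE C T a x0 xt wt = (1 / real T) * (\<Sum>t<T. (norm (C *v (xt t - G a x0 wt t)))\<^sup>2)"

definition J_hat ::
  "((real^'x) \<times> (real^'x) \<times> (real^'w) \<Rightarrow> real) \<Rightarrow> nat \<Rightarrow> nat \<Rightarrow>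
   (nat \<Rightarrow> real^'w) \<times> (nat \<Rightarrow> nat \<Rightarrow> real^'x) \<Rightarrow> real" where
  "J_hat r N T \<Xi> = (case \<Xi> of (wt, xt) \<Rightarrow>
     (1 / (real N * real T)) * (\<Sum>i=1..N. \<Sum>t=1..T. r (z_data wt (xt i) t)))"

end

theory Submission
  imports Defs
begin

text \<open>
  Write \<open>e\<close> and \<open>f\<close> for \<open>e_model \<Psi> \<theta>\<close> and \<open>f_model \<Phi> \<theta>\<close>. Both inequalities behind \<open>Theta_set\<close> are
  dissipation inequalities for the same storage function
  \<open>V(x, y) = 2 (x - y) \<bullet> (e x - e y) - |x - y|\<^sup>2\<^sub>P\<close>. Take \<open>\<Delta>\<close> to be the difference of two trajectories
  at time \<open>t\<close> and \<open>q\<close> their difference at time \<open>t + 1\<close>. Since a trajectory of the model satisfies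
  \<open>f (x\<^sub>t, w\<^sub>t\<^sub>+\<^sub>1) = e (x\<^sub>t\<^sub>+\<^sub>1)\<close>, the terms in \<open>\<Delta>\<close> form \<open>V\<close> at time \<open>t\<close>, those in \<open>q\<close> form \<open>- V\<close> at
  time \<open>t + 1\<close>, and nonnegativity of the right-hand sides reads

  \<^item> \<open>V\<^sub>t\<^sub>+\<^sub>1 + \<epsilon> |\<Delta>\<^sub>t|\<^sup>2 \<le> V\<^sub>t\<close> for two trajectories of the model;
  \<^item> \<open>V\<^sub>t\<^sub>+\<^sub>1 + |C \<Delta>\<^sub>t|\<^sup>2 \<le> V\<^sub>t + r (z\<^sub>t\<^sub>+\<^sub>1)\<close> for a trajectory of the model against arbitrary data.

  With \<open>q = 0\<close> the second identity also gives \<open>V(x, y) \<ge> \<epsilon> |x - y|\<^sup>2\<close>, so \<open>V\<close> is nonnegative.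
  Telescoping (\<open>dissipation_sum\<close>) therefore yields stability from the first inequality, and the error
  bound from the second, where \<open>V\<^sub>0 = 0\<close> because the simulation starts at the first data point.

  It remains to see that \<open>e\<close> is a bijection, without which the model has no trajectories. As
  \<open>P \<ge> 0\<close>, the lower bound on \<open>V\<close> makes \<open>e\<close> strongly monotone: \<open>e\<close> is injective, and the inverse on
  its range is Lipschitz, so the range is closed. The range is open by invariance of domain, and a
  nonempty open and closed set is the whole space (\<open>strongly_monotone_bij\<close>). This argument needs
  continuity of \<open>e\<close>, which follows from analyticity (\<open>real_analytic_continuous\<close>).
\<close>

section \<open>Continuity of real analytic functions\<close>

text \<open>
  Each coordinate of \<open>x\<close> is at most \<open>h * s\<close> in absolute value, so a monomial of degree \<open>d\<close> gains the
  factor \<open>h ^ d\<close> over its value at the diagonal point; \<open>d \<ge> 1\<close> and \<open>h \<le> 1\<close> give \<open>h ^ d \<le> h\<close>.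
\<close>

lemma abs_monomial_at_le:
  fixes x :: "'a::euclidean_space"
  assumes "norm x \<le> h * s" "0 \<le> h" "h \<le> 1" "0 \<le> s"
    and "\<alpha> \<in> multi_indices" "\<alpha> \<noteq> (\<lambda>_. 0)"
  shows "\<bar>monomial_at \<alpha> x\<bar> \<le> h * monomial_at \<alpha> (s *\<^sub>R One)"
proof -
  have hpow: "(\<Prod>b\<in>Basis. h ^ \<alpha> b) \<le> h"
  proof -
    obtain b where b: "b \<in> Basis" "\<alpha> b \<noteq> 0"
      using assms(5,6) unfolding multi_indices_def by force
    have "(\<Prod>b\<in>Basis. h ^ \<alpha> b) = h ^ (\<Sum>b\<in>Basis. \<alpha> b)"
      by (simp add: power_sum)
    also have "\<dots> \<le> h ^ 1"
    proof (rule power_decreasing)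
      show "1 \<le> (\<Sum>b\<in>Basis. \<alpha> b)"
        using b member_le_sum[OF b(1), of \<alpha>] by simp
    qed (use assms in auto)
    finally show ?thesis by simp
  qed
  have "\<bar>monomial_at \<alpha> x\<bar> = (\<Prod>b\<in>Basis. \<bar>x \<bullet> b\<bar> ^ \<alpha> b)"
    by (simp add: monomial_at_def abs_prod power_abs)
  also have "\<dots> \<le> (\<Prod>b\<in>Basis. (h * s) ^ \<alpha> b)"
    by (intro prod_mono conjI power_mono) (use assms(1) Basis_le_norm order_trans in \<open>auto, blast\<close>)
  also have "\<dots> = (\<Prod>b\<in>Basis. h ^ \<alpha> b) * (\<Prod>b\<in>(Basis::'a set). s ^ \<alpha> b)"
    by (simp add: power_mult_distrib prod.distrib)
  also have "\<dots> \<le> h * (\<Prod>b\<in>(Basis::'a set). s ^ \<alpha> b)"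
    using hpow assms(4) by (intro mult_right_mono prod_nonneg) auto
  also have "(\<Prod>b\<in>(Basis::'a set). s ^ \<alpha> b) = monomial_at \<alpha> (s *\<^sub>R One)"
    by (simp add: monomial_at_def)
  finally show ?thesis .
qed

text \<open>
  In finite dimension unconditional convergence is absolute: this holds for real series, hence for
  each coordinate, and the norm is at most the sum of the absolute values of the coordinates.
\<close>

lemma has_sum_Basis_abs_summable:
  fixes g :: "'i \<Rightarrow> 'b::euclidean_space"
  assumes "(g has_sum l) A"
  shows "(\<lambda>i. norm (g i)) summable_on A"
proof -
  have comp: "(\<lambda>i. \<bar>g i \<bullet> b\<bar>) summable_on A" for b
  proof -
    have "((\<lambda>i. g i \<bullet> b) has_sum (l \<bullet> b)) A"
      using has_sum_bounded_linear[OF bounded_linear_inner_left assms] by (simp add: o_def)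
    then have "(\<lambda>i. g i \<bullet> b) summable_on A"
      by (auto simp: summable_on_def)
    then show ?thesis
      unfolding summable_on_iff_abs_summable_on_real[of "\<lambda>i. g i \<bullet> b"] by simp
  qed
  have "(\<lambda>i. \<Sum>b\<in>B. \<bar>g i \<bullet> b\<bar>) summable_on A" if "finite B" for B
    using that by induction (simp_all add: summable_on_add comp)
  from this[OF finite_Basis] show ?thesis
    by (rule summable_on_comparison_test) (auto simp: norm_le_l1)
qed

text \<open>
  Absolute convergence at one point \<open>p + s *\<^sub>R One\<close> of the diagonal dominates the series on a whole
  neighbourhood of \<open>p\<close>: every term but the constant one gains a factor \<open>norm (x - p) / s\<close>. As the
  centre of the expansion is arbitrary, continuity at the centre is enough.
\<close>

lemma real_analytic_continuous:
  fixes f :: "'a::euclidean_space \<Rightarrow> 'b::euclidean_space"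
  assumes "real_analytic f"
  shows "continuous_on UNIV f"
proof -
  have "isCont f p" for p
  proof -
    obtain \<rho> and c :: "('a \<Rightarrow> nat) \<Rightarrow> 'b" where \<rho>: "\<rho> > 0"
      and hs: "\<And>x. x \<in> ball p \<rho> \<Longrightarrow>
        ((\<lambda>\<alpha>. monomial_at \<alpha> (x - p) *\<^sub>R c \<alpha>) has_sum f x) multi_indices"
      using assms unfolding real_analytic_def by meson
    \<comment> \<open>small enough for the diagonal point \<open>p + s *\<^sub>R One\<close> to lie in the ball; the summand 1
      only keeps the denominator visibly positive\<close>
    define s where "s = \<rho> / (2 * (norm (One::'a) + 1))"
    have s: "s > 0" using \<rho> by (simp add: s_def add_nonneg_pos)
    have "s * norm (One::'a) < \<rho>"
    proof -
      have "s * norm (One::'a) \<le> s * (norm (One::'a) + 1)" using s by simp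
      also have "\<dots> = \<rho> / 2"
        by (simp add: s_def field_simps add_nonneg_eq_0_iff)
      finally show ?thesis using \<rho> by simp
    qed
    then have "p + s *\<^sub>R One \<in> ball p \<rho>" using s by (simp add: dist_norm)
    from has_sum_Basis_abs_summable[OF hs[OF this]]
    have abs: "(\<lambda>\<alpha>. norm (monomial_at \<alpha> (s *\<^sub>R One :: 'a) *\<^sub>R c \<alpha>)) summable_on multi_indices"
      by simp
    define M where "M = (\<Sum>\<^sub>\<infinity>\<alpha>\<in>multi_indices. norm (monomial_at \<alpha> (s *\<^sub>R One :: 'a) *\<^sub>R c \<alpha>))"
    have hs_p: "((\<lambda>\<alpha>. monomial_at \<alpha> (0::'a) *\<^sub>R c \<alpha>) has_sum f p) multi_indices"
      using hs[of p] \<rho> by simp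
    have bound: "norm (f x - f p) \<le> norm (x - p) / s * M"
      if x: "x \<in> ball p \<rho>" "norm (x - p) \<le> s" for x
    proof -
      define h where "h = norm (x - p) / s"
      have h: "0 \<le> h" "h \<le> 1" "norm (x - p) \<le> h * s"
        using s x by (auto simp: h_def)
      have diff: "((\<lambda>\<alpha>. monomial_at \<alpha> (x - p) *\<^sub>R c \<alpha> - monomial_at \<alpha> (0::'a) *\<^sub>R c \<alpha>)
          has_sum (f x - f p)) multi_indices"
        using has_sum_add[OF hs[OF x(1)], of "\<lambda>\<alpha>. - (monomial_at \<alpha> (0::'a) *\<^sub>R c \<alpha>)" "- f p"] hs_p
        by (simp add: has_sum_uminus)
      have le: "norm (monomial_at \<alpha> (x - p) *\<^sub>R c \<alpha> - monomial_at \<alpha> (0::'a) *\<^sub>R c \<alpha>)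
          \<le> h * norm (monomial_at \<alpha> (s *\<^sub>R One :: 'a) *\<^sub>R c \<alpha>)"
        if \<alpha>: "\<alpha> \<in> multi_indices" for \<alpha>
      proof (cases "\<alpha> = (\<lambda>_. 0)")
        case True
        then show ?thesis using h by (simp add: monomial_at_def)
      next
        case False
        \<comment> \<open>the bound for \<open>x = 0\<close> with \<open>h = 0\<close>\<close>
        have zero: "monomial_at \<alpha> (0::'a) = 0"
          using abs_monomial_at_le[of "0::'a" 0 0 \<alpha>] \<alpha> False by simp
        have "\<bar>monomial_at \<alpha> (x - p)\<bar> \<le> h * \<bar>monomial_at \<alpha> (s *\<^sub>R One :: 'a)\<bar>"
          using abs_monomial_at_le[OF h(3) h(1,2) _ \<alpha> False] s h
          by (smt (verit) mult_left_mono)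
        then have "\<bar>monomial_at \<alpha> (x - p)\<bar> * norm (c \<alpha>)
            \<le> h * \<bar>monomial_at \<alpha> (s *\<^sub>R One :: 'a)\<bar> * norm (c \<alpha>)"
          by (rule mult_right_mono) simp
        then show ?thesis by (simp add: zero mult.assoc)
      qed
      have "((\<lambda>\<alpha>. h * norm (monomial_at \<alpha> (s *\<^sub>R One :: 'a) *\<^sub>R c \<alpha>)) has_sum (h * M)) multi_indices"
        unfolding M_def using abs by (intro has_sum_cmult_right has_sum_infsum)
      from norm_infsum_le[OF diff this le] show ?thesis by (simp add: h_def)
    qed
    have "(f \<longlongrightarrow> f p) (at p)"
    proof (rule LIM_zero_cancel, rule Lim_null_comparison)
      have "eventually (\<lambda>x. x \<in> ball p (min \<rho> s)) (at p)"
        using \<rho> s by (intro eventually_at_in_open') auto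
      then show "eventually (\<lambda>x. norm (f x - f p) \<le> norm (x - p) / s * M) (at p)"
        by eventually_elim (rule bound, auto simp: dist_norm norm_minus_commute)
      show "((\<lambda>x. norm (x - p) / s * M) \<longlongrightarrow> 0) (at p)"
        by (rule tendsto_eq_rhs[of _ "norm (p - p) / s * M"]) (intro tendsto_intros, use s in auto)
    qed
    then show ?thesis by (simp add: isCont_def)
  qed
  then show ?thesis by (simp add: continuous_at_imp_continuous_on)
qed

section \<open>Strongly monotone maps\<close>

lemma strongly_monotone_expansive:
  fixes e :: "'a::real_inner \<Rightarrow> 'a"
  assumes "(x - y) \<bullet> (e x - e y) \<ge> c * (norm (x - y))\<^sup>2"
  shows "c * norm (x - y) \<le> norm (e x - e y)"
proof (cases "x = y")
  case False
  have "norm (x - y) * (c * norm (x - y)) \<le> norm (x - y) * norm (e x - e y)"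
    using assms norm_cauchy_schwarz[of "x - y" "e x - e y"]
    by (simp add: power2_eq_square mult_ac)
  then show ?thesis using False by simp
qed simp

lemma strongly_monotone_bij:
  fixes e :: "'a::euclidean_space \<Rightarrow> 'a"
  assumes cont: "continuous_on UNIV e" and c: "c > 0"
    and mono: "\<And>x y. (x - y) \<bullet> (e x - e y) \<ge> c * (norm (x - y))\<^sup>2"
  shows "bij e"
proof -
  have exp: "c * norm (x - y) \<le> norm (e x - e y)" for x y
    by (rule strongly_monotone_expansive[OF mono])
  have "inj e"
  proof (rule injI)
    fix x y assume "e x = e y"
    then show "x = y" using exp[of x y] c by (simp add: mult_le_0_iff)
  qed
  moreover have "open (range e)"
    using \<open>inj e\<close> cont by (intro invariance_of_domain) auto
  \<comment> \<open>expansiveness pulls a Cauchy sequence in the range back to a Cauchy sequence of arguments,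
    whose limit continuity maps to the limit of the given sequence\<close>
  moreover have "closed (range e)"
  proof (rule complete_imp_closed, unfold complete_def, intro allI impI, elim conjE)
    fix u assume u: "\<forall>n. u n \<in> range e" "Cauchy u"
    from u(1) have "\<forall>n. \<exists>x. u n = e x" by auto
    then obtain v where v: "\<And>n. u n = e (v n)" by metis
    have "Cauchy v"
    proof (rule metric_CauchyI)
      fix h :: real assume "h > 0"
      then obtain M where M: "\<And>m n. m \<ge> M \<Longrightarrow> n \<ge> M \<Longrightarrow> dist (u m) (u n) < c * h"
        using metric_CauchyD[OF u(2), of "c * h"] c by auto
      have "dist (v m) (v n) < h" if "m \<ge> M" "n \<ge> M" for m n
      proof -
        have "c * dist (v m) (v n) < c * h"
          using exp[of "v m" "v n"] M[OF that] by (simp add: v dist_norm)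
        then show ?thesis using c by simp
      qed
      then show "\<exists>M. \<forall>m\<ge>M. \<forall>n\<ge>M. dist (v m) (v n) < h" by blast
    qed
    then obtain l where "v \<longlonglongrightarrow> l"
      using Cauchy_convergent convergent_def by blast
    then have "u \<longlonglongrightarrow> e l"
      unfolding v using cont by (intro continuous_on_tendsto_compose[OF cont]) auto
    then show "\<exists>l\<in>range e. u \<longlonglongrightarrow> l" by blast
  qed
  ultimately show ?thesis
    using clopen[of "range e"] by (auto simp: bij_def)
qed

section \<open>Telescoping a dissipation inequality\<close>

text \<open>
  Read \<open>V\<close> as stored energy, \<open>a\<close> as dissipation and \<open>s\<close> as supply.
\<close>

lemma dissipation_sum:
  fixes V a s :: "nat \<Rightarrow> 'a::ordered_ab_group_add"
  assumes "\<And>t. t < T \<Longrightarrow> V (Suc t) + a t \<le> V t + s t"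
  shows "V T + (\<Sum>t<T. a t) \<le> V 0 + (\<Sum>t<T. s t)"
  using assms
proof (induction T)
  case (Suc T)
  have "(V T + (\<Sum>t<T. a t)) + (V (Suc T) + a T) \<le> (V 0 + (\<Sum>t<T. s t)) + (V T + s T)"
    using Suc.IH[OF Suc.prems] Suc.prems[of T] by (metis (no_types) add.commute add_mono less_Suc_eq)
  then have "V T + (V (Suc T) + (\<Sum>t<Suc T. a t)) \<le> V T + (V 0 + (\<Sum>t<Suc T. s t))"
    by (simp add: ac_simps)
  then show ?case by (simp only: add_le_cancel_left)
qed simp

lemma summable_of_dissipation:
  fixes V a :: "nat \<Rightarrow> real"
  assumes "\<And>t. V (Suc t) + a t \<le> V t" and "\<And>t. 0 \<le> V t" and "\<And>t. 0 \<le> a t"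
  shows "summable a"
proof (rule summableI_nonneg_bounded)
  show "(\<Sum>t<T. a t) \<le> V 0" for T
    using dissipation_sum[of T V a "\<lambda>_. 0"] assms(1,2)[of T] assms(1) by auto
qed (rule assms(3))

section \<open>The storage function\<close>

lemma wnorm2_zero [simp]: "wnorm2 P 0 = 0"
  by (simp add: wnorm2_def)

lemma wnorm2_add: "wnorm2 (P + Q) v = wnorm2 P v + wnorm2 Q v"
  by (simp add: wnorm2_def matrix_vector_mult_add_rdistrib inner_add_right)

lemma wnorm2_diff: "wnorm2 (P - Q) v = wnorm2 P v - wnorm2 Q v"
  by (simp add: wnorm2_def matrix_vector_mult_diff_rdistrib inner_diff_right)

lemma wnorm2_minus [simp]: "wnorm2 P (- v) = wnorm2 P v"
  using matrix_vector_mult_diff_distrib[of P 0 v] by (simp add: wnorm2_def)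

lemma wnorm2_mat: "wnorm2 (mat c) v = c * (norm v)\<^sup>2"
proof -
  have "mat c *v v = c *\<^sub>R v"
    by (simp add: mat_def matrix_vector_mult_def vec_eq_iff if_distrib if_distribR
        sum.delta cong: if_cong)
  then show ?thesis by (simp add: wnorm2_def power2_norm_eq_inner)
qed

lemma wnorm2_gram: "wnorm2 (transpose C ** C) v = (norm (C *v v))\<^sup>2"
  by (simp add: wnorm2_def power2_norm_eq_inner inner_commute[of v] dot_lmul_matrix
      flip: matrix_vector_mul_assoc)

lemma wnorm2_nonneg: "mat_ge S 0 \<Longrightarrow> 0 \<le> wnorm2 S v"
  by (simp add: mat_ge_def psd_def)

definition storage :: "real^'n^'n \<Rightarrow> (real^'n \<Rightarrow> real^'n) \<Rightarrow> real^'n \<Rightarrow> real^'n \<Rightarrow> real" where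
  "storage P e x y = 2 * ((x - y) \<bullet> (e x - e y)) - wnorm2 P (x - y)"

lemma storage_self [simp]: "storage P e x x = 0"
  by (simp add: storage_def)

text \<open>
  The identities are used at \<open>\<Delta> = x - y\<close> and \<open>q = x' - y'\<close>, where the primes mark successors. In the
  first inequality \<open>y\<close> and \<open>y'\<close> stand for data (\<open>y'\<close> is the variable \<open>\<xi>\<close>), so the model equation is
  asked of \<open>x\<close> alone; in the second both pairs come from the model. Coercivity of the storage
  function is the second identity at \<open>q = 0\<close>.
\<close>

lemma Theta_set_dissipation:
  assumes "(\<theta>, r) \<in> Theta_set C \<Phi> \<Psi> N \<delta> pi_fun"
  obtains P \<epsilon> where "\<epsilon> > 0" and "mat_ge P (mat \<delta>)"
    and "\<And>x y. \<epsilon> * (norm (x - y))\<^sup>2 \<le> storage P (e_model \<Psi> \<theta>) x y"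
    and "\<And>x y x' y' w. e_model \<Psi> \<theta> x' = f_model \<Phi> \<theta> (x, w) \<Longrightarrow>
      storage P (e_model \<Psi> \<theta>) x' y' + (norm (C *v (x - y)))\<^sup>2
        \<le> storage P (e_model \<Psi> \<theta>) x y + r (y', y, w)"
    and "\<And>x y x' y' w. e_model \<Psi> \<theta> x' = f_model \<Phi> \<theta> (x, w) \<Longrightarrow>
      e_model \<Psi> \<theta> y' = f_model \<Phi> \<theta> (y, w) \<Longrightarrow>
      storage P (e_model \<Psi> \<theta>) x' y' + \<epsilon> * (norm (x - y))\<^sup>2 \<le> storage P (e_model \<Psi> \<theta>) x y"
proof -
  let ?e = "e_model \<Psi> \<theta>" and ?f = "f_model \<Phi> \<theta>"
  obtain P S1 S2 \<epsilon> where *: "\<epsilon> > 0" "mat_ge P (mat \<delta>)" "mat_ge S1 0" "mat_ge S2 0"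
    and id1: "\<And>\<xi> x w \<Delta> q. r (\<xi>, x, w) + 2 * (\<Delta> \<bullet> (?e (x + \<Delta>) - ?e x))
               - wnorm2 (P + transpose C ** C) \<Delta> + wnorm2 P q - 2 * (q \<bullet> (?f (x + \<Delta>, w) - ?e \<xi>))
             = wnorm2 S1 (pi_fun (\<xi>, x, w, \<Delta>, q))"
    and id2: "\<And>\<xi> x w \<Delta> q. 2 * (\<Delta> \<bullet> (?e (x + \<Delta>) - ?e x))
               - wnorm2 (P + mat \<epsilon>) \<Delta> + wnorm2 P q - 2 * (q \<bullet> (?f (x + \<Delta>, w) - ?f (x, w)))
             = wnorm2 S2 (pi_fun (\<xi>, x, w, \<Delta>, q))"
    using assms unfolding Theta_set_def by blast
  have ineq1: "storage P ?e x y + r (y', y, w) - (norm (C *v (x - y)))\<^sup>2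
      + wnorm2 P q - 2 * (q \<bullet> (?f (x, w) - ?e y')) \<ge> 0" for x y y' w q
    using id1[of y' y w "x - y" q] wnorm2_nonneg[OF *(3), of "pi_fun (y', y, w, x - y, q)"]
    by (simp add: storage_def wnorm2_add wnorm2_gram)
  have ineq2: "storage P ?e x y - \<epsilon> * (norm (x - y))\<^sup>2
      + wnorm2 P q - 2 * (q \<bullet> (?f (x, w) - ?f (y, w))) \<ge> 0" for x y w q
    using id2[of "x - y" y q w 0] wnorm2_nonneg[OF *(4), of "pi_fun (0, y, w, x - y, q)"]
    by (simp add: storage_def wnorm2_add wnorm2_mat)
  show thesis
  proof (rule that[OF *(1,2)])
    show "\<epsilon> * (norm (x - y))\<^sup>2 \<le> storage P ?e x y" for x y
      using ineq2[of x y 0 0] by simp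
    show "storage P ?e x' y' + (norm (C *v (x - y)))\<^sup>2 \<le> storage P ?e x y + r (y', y, w)"
      if "?e x' = ?f (x, w)" for x y x' y' w
      using ineq1[of x y y' w "x' - y'"] that by (simp add: storage_def)
    show "storage P ?e x' y' + \<epsilon> * (norm (x - y))\<^sup>2 \<le> storage P ?e x y"
      if "?e x' = ?f (x, w)" "?e y' = ?f (y, w)" for x y x' y' w
      using ineq2[of x y "x' - y'" w] that by (simp add: storage_def)
  qed
qed

section \<open>Stability and the error bound\<close>

lemma e_model_continuous:
  assumes "\<And>i. real_analytic (\<Psi> i)"
  shows "continuous_on UNIV (e_model \<Psi> \<theta>)"
  unfolding e_model_def by (intro continuous_intros real_analytic_continuous assms)

text \<open>
  As \<open>P \<ge> \<delta> I \<ge> 0\<close>, coercivity of the storage function survives without its term in \<open>P\<close>; the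
  factor 2 in front of the inner product makes the constant of strong monotonicity \<open>\<epsilon> / 2\<close>.
\<close>

lemma e_model_bij:
  assumes "\<And>i. real_analytic (\<Psi> i)" and "0 \<le> \<delta>"
    and "(\<theta>, r) \<in> Theta_set C \<Phi> \<Psi> N \<delta> pi_fun"
  shows "bij (e_model \<Psi> \<theta>)"
proof -
  obtain P \<epsilon> where *: "\<epsilon> > 0" "mat_ge P (mat \<delta>)"
    and coercive: "\<And>x y. \<epsilon> * (norm (x - y))\<^sup>2 \<le> storage P (e_model \<Psi> \<theta>) x y"
    using Theta_set_dissipation[OF assms(3)] by metis
  have P: "wnorm2 P v \<ge> 0" for v
  proof -
    have "0 \<le> \<delta> * (norm v)\<^sup>2" using assms(2) by simp
    also have "\<dots> \<le> wnorm2 P v"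
      using *(2) unfolding mat_ge_def psd_def by (simp add: wnorm2_diff wnorm2_mat)
    finally show ?thesis .
  qed
  show ?thesis
  proof (rule strongly_monotone_bij[OF e_model_continuous[OF assms(1)]])
    show "\<epsilon> / 2 > 0" using *(1) by simp
    show "\<epsilon> / 2 * (norm (x - y))\<^sup>2 \<le> (x - y) \<bullet> (e_model \<Psi> \<theta> x - e_model \<Psi> \<theta> y)" for x y
      using coercive[of x y] P[of "x - y"] by (simp add: storage_def)
  qed
qed

lemma e_model_G_Suc:
  assumes "bij (e_model \<Psi> \<theta>)"
  shows "e_model \<Psi> \<theta> (G (a_model \<Phi> \<Psi> \<theta>) x0 w (Suc t))
    = f_model \<Phi> \<theta> (G (a_model \<Phi> \<Psi> \<theta>) x0 w t, w (Suc t))"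
  using assms by (simp add: a_model_def bij_is_surj surj_f_inv_f)

lemma Theta_set_l2_incrementally_stable:
  assumes mem: "(\<theta>, r) \<in> Theta_set C \<Phi> \<Psi> N \<delta> pi_fun" and bij: "bij (e_model \<Psi> \<theta>)"
  shows "l2_incrementally_stable (a_model \<Phi> \<Psi> \<theta>)"
  unfolding l2_incrementally_stable_def
proof (intro allI)
  fix x0 y0 w
  let ?x = "G (a_model \<Phi> \<Psi> \<theta>) x0 w" and ?y = "G (a_model \<Phi> \<Psi> \<theta>) y0 w"
  obtain P \<epsilon> where \<epsilon>: "\<epsilon> > 0"
    and coercive: "\<And>x y. \<epsilon> * (norm (x - y))\<^sup>2 \<le> storage P (e_model \<Psi> \<theta>) x y"
    and diss: "\<And>x y x' y' w. e_model \<Psi> \<theta> x' = f_model \<Phi> \<theta> (x, w) \<Longrightarrow>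
      e_model \<Psi> \<theta> y' = f_model \<Phi> \<theta> (y, w) \<Longrightarrow>
      storage P (e_model \<Psi> \<theta>) x' y' + \<epsilon> * (norm (x - y))\<^sup>2 \<le> storage P (e_model \<Psi> \<theta>) x y"
    using Theta_set_dissipation[OF mem] by metis
  have "summable (\<lambda>t. \<epsilon> * (norm (?x t - ?y t))\<^sup>2)"
  proof (rule summable_of_dissipation)
    show "storage P (e_model \<Psi> \<theta>) (?x (Suc t)) (?y (Suc t)) + \<epsilon> * (norm (?x t - ?y t))\<^sup>2
        \<le> storage P (e_model \<Psi> \<theta>) (?x t) (?y t)" for t
      by (rule diss[OF e_model_G_Suc[OF bij] e_model_G_Suc[OF bij]])
    show "0 \<le> \<epsilon> * (norm (?x t - ?y t))\<^sup>2" for t using \<epsilon> by simp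
    then show "0 \<le> storage P (e_model \<Psi> \<theta>) (?x t) (?y t)" for t
      using coercive order_trans by blast
  qed
  then show "summable (\<lambda>t. (norm (?x t - ?y t))\<^sup>2)"
    using \<epsilon> by (simp add: summable_cmult_iff)
qed

text \<open>
  The simulation is compared with the data \<open>y\<close>, which need not be a trajectory of the model:
  \<open>r\<close> bounds the energy supplied by the equation error. The energy is \<open>0\<close> at the start, because both
  sequences start at \<open>y 0\<close>, and nonnegative at time \<open>T\<close>.
\<close>

lemma J_SE_le:
  assumes mem: "(\<theta>, r) \<in> Theta_set C \<Phi> \<Psi> N \<delta> pi_fun" and bij: "bij (e_model \<Psi> \<theta>)"
  shows "J_SE C T (a_model \<Phi> \<Psi> \<theta>) (y 0) y w \<le> (1 / real T) * (\<Sum>t=1..T. r (z_data w y t))"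
proof -
  let ?x = "G (a_model \<Phi> \<Psi> \<theta>) (y 0) w"
  obtain P \<epsilon> where \<epsilon>: "\<epsilon> > 0"
    and coercive: "\<And>x y. \<epsilon> * (norm (x - y))\<^sup>2 \<le> storage P (e_model \<Psi> \<theta>) x y"
    and diss: "\<And>x y x' y' w. e_model \<Psi> \<theta> x' = f_model \<Phi> \<theta> (x, w) \<Longrightarrow>
      storage P (e_model \<Psi> \<theta>) x' y' + (norm (C *v (x - y)))\<^sup>2
        \<le> storage P (e_model \<Psi> \<theta>) x y + r (y', y, w)"
    using Theta_set_dissipation[OF mem] by metis
  let ?V = "\<lambda>t. storage P (e_model \<Psi> \<theta>) (?x t) (y t)"
  have "?V T + (\<Sum>t<T. (norm (C *v (?x t - y t)))\<^sup>2)
      \<le> ?V 0 + (\<Sum>t<T. r (y (Suc t), y t, w (Suc t)))"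
    by (intro dissipation_sum diss e_model_G_Suc bij)
  moreover have "0 \<le> ?V T"
    using coercive[of "?x T" "y T"] \<epsilon> by (smt (verit) mult_nonneg_nonneg zero_le_power2)
  moreover have "(\<Sum>t<T. r (y (Suc t), y t, w (Suc t))) = (\<Sum>t=1..T. r (z_data w y t))"
    by (simp add: z_data_def sum.atLeast1_atMost_eq)
  moreover have "norm (C *v (?x t - y t)) = norm (C *v (y t - ?x t))" for t
    by (simp add: matrix_vector_mult_diff_distrib norm_minus_commute)
  ultimately have "(\<Sum>t<T. (norm (C *v (y t - ?x t)))\<^sup>2) \<le> (\<Sum>t=1..T. r (z_data w y t))"
    by simp
  then show ?thesis
    unfolding J_SE_def by (intro mult_left_mono) auto
qed

theorem lemma1:
  fixes C :: "real^'x^'y"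
    and \<Phi> :: "'k::finite \<Rightarrow> (real^'x) \<times> (real^'w) \<Rightarrow> real^'x"
    and \<Psi> :: "'k \<Rightarrow> real^'x \<Rightarrow> real^'x"
    and N :: nat and \<delta> :: real
    and pi_fun :: "(real^'x) \<times> (real^'x) \<times> (real^'w) \<times> (real^'x) \<times> (real^'x) \<Rightarrow> real^'p"
    and \<Theta> :: "(real^'k) set"
  assumes "\<And>i. real_analytic (\<Phi> i)"
    and "\<And>i. real_analytic (\<Psi> i)"
    and "N > 0" and "\<delta> > 0"
    and "\<Theta> = {\<theta>. \<exists>r. (\<theta>, r) \<in> Theta_set C \<Phi> \<Psi> N \<delta> pi_fun}"
    and "\<Theta> \<noteq> {}"
  shows "stable_projective_parameterization \<Theta> \<Phi> \<Psi> \<and>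
    (\<forall>(\<theta>, r) \<in> Theta_set C \<Phi> \<Psi> N \<delta> pi_fun. \<forall>T\<ge>1. \<forall>(wt, xt) \<in> data_sets N T.
       J_hat r N T (wt, xt) \<ge>
         (1 / real N) * (\<Sum>i=1..N. J_SE C T (a_model \<Phi> \<Psi> \<theta>) (xt i 0) (xt i) wt))"
proof
  have bij: "bij (e_model \<Psi> \<theta>)" if "(\<theta>, r) \<in> Theta_set C \<Phi> \<Psi> N \<delta> pi_fun" for \<theta> r
    using e_model_bij[OF assms(2) _ that] assms(4) by simp
  show "stable_projective_parameterization \<Theta> \<Phi> \<Psi>"
    unfolding stable_projective_parameterization_def
    using assms(5,6) bij Theta_set_l2_incrementally_stable by blast
  have "(1 / real N) * (\<Sum>i=1..N. J_SE C T (a_model \<Phi> \<Psi> \<theta>) (xt i 0) (xt i) wt)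
      \<le> J_hat r N T (wt, xt)"
    if mem: "(\<theta>, r) \<in> Theta_set C \<Phi> \<Psi> N \<delta> pi_fun" for \<theta> r T wt and xt :: "nat \<Rightarrow> nat \<Rightarrow> real^'x"
  proof -
    have "(1 / real N) * (\<Sum>i=1..N. J_SE C T (a_model \<Phi> \<Psi> \<theta>) (xt i 0) (xt i) wt)
        \<le> (1 / real N) * (\<Sum>i=1..N. (1 / real T) * (\<Sum>t=1..T. r (z_data wt (xt i) t)))"
      by (intro mult_left_mono sum_mono J_SE_le[OF mem bij[OF mem]]) simp
    also have "\<dots> = J_hat r N T (wt, xt)"
      by (simp add: J_hat_def flip: sum_divide_distrib)
    finally show ?thesis .
  qed
  then show "\<forall>(\<theta>, r) \<in> Theta_set C \<Phi> \<Psi> N \<delta> pi_fun. \<forall>T\<ge>1. \<forall>(wt, xt) \<in> data_sets N T.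
       J_hat r N T (wt, xt) \<ge>
         (1 / real N) * (\<Sum>i=1..N. J_SE C T (a_model \<Phi> \<Psi> \<theta>) (xt i 0) (xt i) wt)"
    by blast
qed

end
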